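(* Let $E\subset\mathbb{R}^d$ be a non-empty compact set. Then $$\underline{\dim}_{\rm MB}E=\sup S(E)=\sup_{F\subset E}\ \inf_{\{r_k\}_k\searrow 0}\ \sup_{\mu:\,\mathrm{spt}\,\mu=F}\ \limsup_{k\to\infty}\ \inf_{x\in E}\frac{\log\mu(B(x,r_k))}{\log r_k},$$ where $S(E)$ is the set of all $s\ge 0$ with the following property: there exists a non-empty compact set $F\subset E$ such that for every sequence $\{r_k\}_k\searrow 0$ there exist a subsequence $\{r_{k_i}\}_i$ of $\{r_k\}_k$ and a Borel measure $\mu$ on $\mathbb{R}^d$ with $\mathrm{spt}\,\mu=F$ such that $$\mu(B(x,r_{k_i}))\le r_{k_i}^{s}\quad\text{for all }x\in\mathbb{R}^d\text{ and all }i\in\mathbb{N}.$$ In the last expression, the outer supremum is over non-empty compact sets $F\subset E$, the infimum is over all sequences $\{r_k\}_k\searrow 0$, and the inner supremum is over Borel measures $\mu$ on $\mathbb{R}^d$ with $\mathrm{spt}\,\mu=F$.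
   Context: $B(x,r)$ is the closed Euclidean ball in $\mathbb{R}^d$ with centre $x$ and radius $r$. The notation $\{r_k\}_k\searrow 0$ means a sequence of positive reals decreasing to $0$. $\mathrm{spt}\,\mu$ is the (closed) support of $\mu$. For $0<r<1$ we use $\log 0/\log r=+\infty$ and $\log(+\infty)/\log r=-\infty$. For non-empty bounded $A\subset\mathbb{R}^d$ and $r>0$, let $N_r(A)$ be the least number of sets of diameter $r$ that can cover $A$. The lower box-counting dimension is $\underline{\dim}_{\rm B}A=\liminf_{r\to0}\frac{\log N_r(A)}{-\log r}$. The modified lower box dimension is $$\underline{\dim}_{\rm MB}E=\inf\Big\{\sup_i\underline{\dim}_{\rm B}E_i:\ E\subset\bigcup_{i=1}^\infty E_i,\ E_i\text{ (non-empty) compact}\Big\},$$ the infimum being over all countable covers of $E$ by compact sets. *)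

theory Defs
  imports "HOL-Analysis.Analysis"
begin

text \<open>
  \<open>covering_number r A\<close> is the number \<open>N\<^sub>r(A)\<close>. The library's \<^const>\<open>diameter\<close> is a
  real-valued supremum with an unspecified value on unbounded sets, hence the explicit
  boundedness requirement on the covering sets.
\<close>

definition covering_number :: "real \<Rightarrow> 'a::metric_space set \<Rightarrow> nat" where
  "covering_number r A =
    (LEAST n. \<exists>\<U>. finite \<U> \<and> card \<U> = n \<and> A \<subseteq> \<Union>\<U> \<and>
                 (\<forall>U\<in>\<U>. bounded U \<and> diameter U = r))"

definition lower_box_dim :: "'a::metric_space set \<Rightarrow> ereal" where
  "lower_box_dim A =
    Liminf (at_right 0) (\<lambda>r. ereal (ln (real (covering_number r A)) / (- ln r)))"

text \<open>
  Countable covers are indexed by \<^typ>\<open>nat\<close>; finite ones are included because members may repeat.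
\<close>

definition modified_lower_box_dim :: "'a::metric_space set \<Rightarrow> ereal" where
  "modified_lower_box_dim E =
    Inf {(SUP i. lower_box_dim (K i)) | K :: nat \<Rightarrow> 'a set.
           E \<subseteq> (\<Union>i. K i) \<and> (\<forall>i. compact (K i) \<and> K i \<noteq> {})}"

definition borel_measure :: "'a::topological_space measure \<Rightarrow> bool" where
  "borel_measure \<mu> \<longleftrightarrow> sets \<mu> = sets borel"

definition spt :: "'a::topological_space measure \<Rightarrow> 'a set" where
  "spt \<mu> = - \<Union>{U. open U \<and> emeasure \<mu> U = 0}"

text \<open>
  Strict monotonicity is not required in \<open>{r\<^sub>k}\<^sub>k \<searrow> 0\<close>.
\<close>

definition decreases_to_0 :: "(nat \<Rightarrow> real) \<Rightarrow> bool" where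
  "decreases_to_0 r \<longleftrightarrow> (\<forall>k. r k > 0) \<and> decseq r \<and> r \<longlonglongrightarrow> 0"

text \<open>
  \<open>log_ratio m r\<close> is \<open>log m / log r\<close>, with the values at \<open>m = 0\<close> and \<open>m = \<infinity>\<close> appropriate for
  \<open>0 < r < 1\<close>. Other values of \<open>r\<close> occur only in finitely many terms of a sequence
  decreasing to \<open>0\<close>, so they do not affect upper limits.
\<close>

definition log_ratio :: "ennreal \<Rightarrow> real \<Rightarrow> ereal" where
  "log_ratio m r =
    (if m = 0 then \<infinity> else if m = \<infinity> then - \<infinity> else ereal (ln (enn2real m) / ln r))"

text \<open>
  \<open>frostman_exponents E\<close> is the set \<open>S(E)\<close>.
\<close>

definition frostman_exponents :: "'a::metric_space set \<Rightarrow> real set" where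
  "frostman_exponents E =
    {s. s \<ge> 0 \<and>
        (\<exists>F. F \<noteq> {} \<and> compact F \<and> F \<subseteq> E \<and>
          (\<forall>r. decreases_to_0 r \<longrightarrow>
            (\<exists>\<phi> :: nat \<Rightarrow> nat. \<exists>\<mu> :: 'a measure.
               strict_mono \<phi> \<and> borel_measure \<mu> \<and> spt \<mu> = F \<and>
               (\<forall>x i. emeasure \<mu> (cball x (r (\<phi> i))) \<le> ennreal (r (\<phi> i) powr s)))))}"

end

theory Submission
  imports Defs
begin

text \<open>
  Write \<open>dim\<close> for the modified lower box dimension of \<open>E\<close> and \<open>S\<close> for the set of Frostman exponents.

  \<^bold>\<open>\<open>S\<close> is bounded by \<open>dim\<close>.\<close>  Let \<open>F\<close> witness \<open>s \<in> S\<close> and let \<open>E\<close> be covered by compact sets \<open>K\<^sub>i\<close>. By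
  Baire's theorem some \<open>K\<^sub>i\<close> contains \<open>V \<inter> F\<close> for an open \<open>V\<close> meeting \<open>F\<close>. If \<open>K\<^sub>i\<close> had lower box
  dimension below some \<open>t < s\<close>, it would be covered by \<open>r powr (-t)\<close> balls of radius \<open>r\<close> for a sequence of
  radii tending to \<open>0\<close>. Along a subsequence a measure with support \<open>F\<close> gives each ball mass at most
  \<open>r powr s\<close>, hence \<open>V\<close> mass at most \<open>r powr (s - t)\<close>, which tends to \<open>0\<close>; but \<open>V\<close> meets the support
  (\<open>frostman_exponent_le_lower_box_dim\<close>).

  \<^bold>\<open>\<open>dim\<close> is bounded by \<open>sup S\<close>.\<close>  Let \<open>t < s < dim\<close>. Removing from \<open>E\<close> every open set whose trace has a
  countable compact cover of dimension at most \<open>s\<close> leaves a compact \<open>F\<close> with dimension above \<open>s\<close> in each ball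
  around each of its points (\<open>exists_uniformly_large_subset\<close>). So at every sufficiently small scale \<open>r\<close>
  there are \<open>r powr (-t)\<close> well separated points of \<open>F\<close> near each point of \<open>F\<close>, and by compactness
  "sufficiently small" can be chosen uniformly over \<open>F\<close> (\<open>eventually_separated_points_everywhere\<close>).
  Given radii tending to \<open>0\<close>, choose a subsequence \<open>\<rho>\<^sub>i\<close>, each term tiny compared with the
  preceding one, and distribute mass as in a Cantor set: a point used at scale \<open>\<rho>\<^sub>i\<close> passes its mass in equal
  shares to its separated points for scale \<open>\<rho>\<^sub>i\<^sub>+\<^sub>1\<close>. A ball of radius \<open>\<rho>\<^sub>i\<close> then sees at most one
  share from each parent, so its mass is at most \<open>\<rho>\<^sub>i powr t\<close> (\<open>exists_cantor_measure\<close>). Such a measure lives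
  near its starting point. To get the full support \<open>F\<close>, add up measures started at a dense sequence
  of points, the \<open>n\<close>-th of them at stage \<open>n\<close> and with a weight so small that it is harmless at the
  scales before stage \<open>n\<close> (\<open>exists_frostman_measure\<close>).

  \<^bold>\<open>The two suprema agree.\<close>  For \<open>0 < r < 1\<close> the condition \<open>\<mu>(B(x,r)) \<le> r powr s\<close> says that the logarithmic
  ratio is at least \<open>s\<close>, and an upper limit exceeding \<open>s\<close> yields a subsequence. The ratio is controlled only at
  centres in \<open>E\<close>, whereas \<open>S\<close> asks for all centres. This costs a constant factor depending on the
  space (\<open>cball_measure_bound_from_spt\<close>), which is removed by rescaling \<open>\<mu>\<close>.
\<close>

section \<open>Covering numbers and separated sets\<close>

lemma covering_number_le:
  assumes "finite \<U>" "A \<subseteq> \<Union>\<U>" "\<And>U. U \<in> \<U> \<Longrightarrow> bounded U \<and> diameter U = r"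
  shows "covering_number r A \<le> card \<U>"
  unfolding covering_number_def by (rule Least_le) (use assms in blast)

lemma covering_number_attained:
  fixes A :: "'a::euclidean_space set"
  assumes "compact A" "r > 0"
  obtains \<U> where "finite \<U>" "card \<U> = covering_number r A" "A \<subseteq> \<Union>\<U>"
    "\<And>U. U \<in> \<U> \<Longrightarrow> bounded U \<and> diameter U = r"
proof -
  have "A \<subseteq> (\<Union>a\<in>A. ball a (r/2))" using assms(2) by auto
  then obtain D where D: "D \<subseteq> A" "finite D" "A \<subseteq> (\<Union>a\<in>D. ball a (r/2))"
    using compactE_image[OF assms(1), of A "\<lambda>a. ball a (r/2)"] by auto
  let ?\<U> = "(\<lambda>a. cball a (r/2)) ` D"
  have "A \<subseteq> \<Union>?\<U>" using D(3) by force
  moreover have "\<forall>U\<in>?\<U>. bounded U \<and> diameter U = r" using assms(2) by auto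
  ultimately have "\<exists>\<U>. finite \<U> \<and> card \<U> = card ?\<U> \<and> A \<subseteq> \<Union>\<U> \<and> (\<forall>U\<in>\<U>. bounded U \<and> diameter U = r)"
    using D(2) by blast
  from LeastI[where P="\<lambda>n. \<exists>\<U>. finite \<U> \<and> card \<U> = n \<and> A \<subseteq> \<Union>\<U> \<and> (\<forall>U\<in>\<U>. bounded U \<and> diameter U = r)", OF this]
  show thesis
    unfolding covering_number_def[symmetric] using that by blast
qed

lemma covering_number_pos:
  fixes A :: "'a::euclidean_space set"
  assumes "compact A" "A \<noteq> {}" "r > 0"
  shows "covering_number r A > 0"
proof -
  obtain \<U> where "finite \<U>" "card \<U> = covering_number r A" "A \<subseteq> \<Union>\<U>"
    using covering_number_attained[OF assms(1,3)] by metis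
  with assms(2) show ?thesis by (metis Union_empty bot.extremum_uniqueI card_gt_0_iff)
qed

text \<open>A separated set with fewer points than the covering number can be enlarged: the balls
  of radius \<open>4r\<close> around its points are sets of diameter exactly \<open>8r\<close>, and they are too few to cover.\<close>

lemma exists_separated_set:
  fixes A :: "'a::euclidean_space set"
  assumes "r > 0" "n \<le> covering_number (8 * r) A"
  shows "\<exists>T. finite T \<and> card T = n \<and> T \<subseteq> A \<and> (\<forall>x\<in>T. \<forall>y\<in>T. x \<noteq> y \<longrightarrow> dist x y > 4 * r)"
  using assms(2)
proof (induction n)
  case 0
  show ?case by (rule exI[of _ "{}"]) auto
next
  case (Suc n)
  then obtain T where T: "finite T" "card T = n" "T \<subseteq> A"
      "\<forall>x\<in>T. \<forall>y\<in>T. x \<noteq> y \<longrightarrow> dist x y > 4 * r"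
    by auto
  have "\<not> A \<subseteq> \<Union>((\<lambda>x. cball x (4*r)) ` T)"
  proof
    assume "A \<subseteq> \<Union>((\<lambda>x. cball x (4*r)) ` T)"
    then have "covering_number (8*r) A \<le> card ((\<lambda>x. cball x (4*r)) ` T)"
      by (rule covering_number_le[rotated]) (use T(1) assms(1) in auto)
    also have "\<dots> \<le> n" using T(1,2) card_image_le by blast
    finally show False using Suc.prems by simp
  qed
  then obtain a where a: "a \<in> A" "\<And>x. x \<in> T \<Longrightarrow> dist x a > 4*r" by force
  have "a \<notin> T" using a(2)[of a] assms(1) by auto
  then show ?case
    using T a by (intro exI[of _ "insert a T"]) (auto simp: dist_commute)
qed

section \<open>Supports\<close>

text \<open>The complement of the support is a union of possibly uncountably many null sets. By
  Lindelof's property countably many of them suffice.\<close>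
lemma emeasure_compl_spt:
  fixes \<mu> :: "'a::second_countable_topology measure"
  assumes "borel_measure \<mu>"
  shows "emeasure \<mu> (- spt \<mu>) = 0"
proof -
  obtain \<V> where \<V>: "\<V> \<subseteq> {U. open U \<and> emeasure \<mu> U = 0}" "countable \<V>"
      "\<Union>\<V> = \<Union>{U. open U \<and> emeasure \<mu> U = 0}"
    using Lindelof[of "{U. open U \<and> emeasure \<mu> U = 0}"] by blast
  have "(\<Union>V\<in>\<V>. V) \<in> null_sets \<mu>"
    by (rule null_sets_UN'[OF \<V>(2)]) (use \<V>(1) assms in \<open>auto simp: null_sets_def borel_measure_def\<close>)
  then show ?thesis using \<V>(3) by (simp add: spt_def null_sets_def)
qed

lemma emeasure_pos_if_meets_spt:
  assumes "open V" "V \<inter> spt \<mu> \<noteq> {}"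
  shows "emeasure \<mu> V > 0"
  using assms by (auto simp: spt_def zero_less_iff_neq_zero)

section \<open>Decreasing sequences of radii\<close>

lemma decreases_to_0_if_frequently:
  assumes "\<exists>\<^sub>F r in at_right 0. P r"
  obtains r where "decreases_to_0 r" "\<And>k. P (r k)"
proof -
  have small: "\<exists>r>0. r < e \<and> P r" if "e > 0" for e :: real
  proof (rule ccontr)
    assume "\<not> ?thesis"
    then have "\<forall>\<^sub>F r in at_right 0. \<not> P r"
      using that by (auto simp: eventually_at_right_field intro!: exI[of _ e])
    then show False using assms by (simp add: frequently_def)
  qed
  have "\<exists>r. \<forall>n. (0 < r n \<and> P (r n) \<and> r n < inverse (Suc n)) \<and> r (Suc n) \<le> r n"
  proof (rule dependent_nat_choice)
    show "\<exists>x>0. P x \<and> x < inverse (Suc 0)" using small[of 1] by auto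
    fix x :: real and n assume "0 < x \<and> P x \<and> x < inverse (Suc n)"
    then show "\<exists>y. (0 < y \<and> P y \<and> y < inverse (Suc (Suc n))) \<and> y \<le> x"
      using small[of "min x (inverse (Suc (Suc n)))"] by (auto simp del: of_nat_Suc)
  qed
  then obtain r where r: "\<And>n. 0 < r n" "\<And>n. P (r n)" "\<And>n. r n < inverse (Suc n)" "\<And>n. r (Suc n) \<le> r n"
    by auto
  have "r \<longlonglongrightarrow> 0"
    by (rule tendsto_sandwich[OF _ _ tendsto_const LIMSEQ_inverse_real_of_nat])
       (use r in \<open>auto simp: less_imp_le\<close>)
  then have "decreases_to_0 r"
    using r by (auto simp: decreases_to_0_def decseq_Suc_iff)
  then show thesis using that r(2) by blast
qed

lemma eventually_small_radius:
  assumes "decreases_to_0 r" "e > 0"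
  shows "\<forall>\<^sub>F k in sequentially. r k < e"
  using assms by (auto simp: decreases_to_0_def dest: order_tendstoD(2))

section \<open>The upper bound on the exponents\<close>

text \<open>A nonempty set of diameter \<open>r\<close> lies in the closed ball of radius \<open>r\<close> around any of its points,
  so the bound on balls applies to the members of an optimal cover.\<close>
lemma measure_le_covering_number:
  fixes K :: "'a::euclidean_space set"
  assumes "borel_measure \<mu>" "compact K" "r > 0"
    and "\<And>x. emeasure \<mu> (cball x r) \<le> ennreal (r powr s)"
  shows "emeasure \<mu> K \<le> ennreal (covering_number r K * r powr s)"
proof -
  obtain \<U> where \<U>: "finite \<U>" "card \<U> = covering_number r K" "K \<subseteq> \<Union>\<U>"
      "\<And>U. U \<in> \<U> \<Longrightarrow> bounded U \<and> diameter U = r"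
    using covering_number_attained[OF assms(2,3)] by metis
  have "\<exists>u. U \<subseteq> cball u r" if "U \<in> \<U>" for U
  proof (cases "U = {}")
    case False
    then obtain u where "u \<in> U" by auto
    then have "U \<subseteq> cball u r"
      using \<U>(4)[OF that] diameter_bounded_bound by fastforce
    then show ?thesis ..
  qed auto
  then obtain c where c: "\<And>U. U \<in> \<U> \<Longrightarrow> U \<subseteq> cball (c U) r" by metis
  have sets: "sets \<mu> = sets borel" using assms(1) by (simp add: borel_measure_def)
  have "emeasure \<mu> K \<le> emeasure \<mu> (\<Union>U\<in>\<U>. cball (c U) r)"
    by (rule emeasure_mono) (use c \<U>(1,3) in \<open>force simp: sets subset_iff\<close>)+
  also have "\<dots> \<le> (\<Sum>U\<in>\<U>. emeasure \<mu> (cball (c U) r))"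
    by (rule emeasure_subadditive_finite) (use \<U>(1) in \<open>auto simp: sets\<close>)
  also have "\<dots> \<le> (\<Sum>U\<in>\<U>. ennreal (r powr s))"
    by (intro sum_mono assms(4))
  also have "\<dots> = ennreal (covering_number r K * r powr s)"
    using \<U>(2) by (simp add: ennreal_mult ennreal_of_nat_eq_real_of_nat)
  finally show ?thesis .
qed

text \<open>If \<open>K\<close> had dimension below \<open>t < s\<close>, there would be radii \<open>r\<close> tending to \<open>0\<close> at which at most
  \<open>r powr (-t)\<close> sets cover \<open>K\<close>. For a measure adapted to these radii \<open>V\<close> would have mass at most
  \<open>r powr (s - t)\<close> for arbitrarily small \<open>r\<close>, so mass zero, although it meets the support.\<close>
lemma frostman_exponent_le_lower_box_dim:
  fixes K :: "'a::euclidean_space set"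
  assumes "compact K" "K \<noteq> {}" "open V" "V \<inter> F \<noteq> {}" "V \<inter> F \<subseteq> K"
    and frostman: "\<And>r. decreases_to_0 r \<Longrightarrow> \<exists>\<phi> :: nat \<Rightarrow> nat. \<exists>\<mu>. strict_mono \<phi> \<and> borel_measure \<mu> \<and>
          spt \<mu> = F \<and> (\<forall>x i. emeasure \<mu> (cball x (r (\<phi> i))) \<le> ennreal (r (\<phi> i) powr s))"
  shows "ereal s \<le> lower_box_dim K"
proof (rule ccontr)
  assume "\<not> ?thesis"
  then have "lower_box_dim K < ereal s" by simp
  then obtain t where t: "lower_box_dim K < ereal t" "t < s"
    by (metis ereal_dense2 ereal_less(1) less_ereal.simps(1))
  have "\<exists>\<^sub>F r in at_right 0. ereal (ln (covering_number r K) / (- ln r)) < ereal t"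
  proof (rule ccontr)
    assume "\<not> ?thesis"
    then have "\<forall>\<^sub>F r in at_right 0. ereal t \<le> ereal (ln (covering_number r K) / (- ln r))"
      by (simp add: not_frequently not_less)
    from Liminf_bounded[OF this] t(1) show False
      by (simp add: lower_box_dim_def)
  qed
  moreover have "\<forall>\<^sub>F r in at_right (0::real). 0 < r \<and> r < 1"
    by (auto simp: eventually_at_right_field intro!: exI[of _ 1])
  ultimately have "\<exists>\<^sub>F r in at_right 0. 0 < r \<and> r < 1 \<and> covering_number r K \<le> r powr (- t)"
  proof (rule frequently_rev_mp[OF _ eventually_mono], intro impI conjI)
    fix r :: real assume r: "0 < r \<and> r < 1" and *: "ereal (ln (covering_number r K) / (- ln r)) < ereal t"
    show "0 < r" "r < 1" using r by auto
    have "ln (covering_number r K) \<le> (- t) * ln r"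
      using * r by (simp add: field_simps)
    then have "exp (ln (covering_number r K)) \<le> exp ((- t) * ln r)" by simp
    then show "covering_number r K \<le> r powr (- t)"
      using covering_number_pos[OF assms(1,2), of r] r by (simp add: powr_def)
  qed
  then obtain r where r: "decreases_to_0 r"
      and r': "\<And>k. 0 < r k \<and> r k < 1 \<and> covering_number (r k) K \<le> r k powr (- t)"
    using decreases_to_0_if_frequently by (metis (mono_tags, lifting))
  obtain \<phi> :: "nat \<Rightarrow> nat" and \<mu> :: "'a measure" where \<mu>: "strict_mono \<phi>" "borel_measure \<mu>" "spt \<mu> = F"
      "\<And>x i. emeasure \<mu> (cball x (r (\<phi> i))) \<le> ennreal (r (\<phi> i) powr s)"
    using frostman[OF r] by blast
  have sets: "sets \<mu> = sets borel" using \<mu>(2) by (simp add: borel_measure_def)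
  have V: "V \<in> sets \<mu>" "K \<in> sets \<mu>"
    using assms(1,3) by (simp_all add: sets borel_compact)
  have "open (- spt \<mu>)" by (auto simp: spt_def)
  then have "- spt \<mu> \<in> sets \<mu>" by (simp add: sets)
  note V = V this
  \<comment> \<open>\<open>K\<close> contains only the part of \<open>V\<close> in the support, but the rest of \<open>V\<close> is null.\<close>
  have "emeasure \<mu> V \<le> emeasure \<mu> (K \<union> - spt \<mu>)"
    by (rule emeasure_mono) (use assms(5) \<mu>(3) V in auto)
  also have "\<dots> \<le> emeasure \<mu> K + emeasure \<mu> (- spt \<mu>)"
    by (rule emeasure_subadditive) (use V in auto)
  finally have VK: "emeasure \<mu> V \<le> emeasure \<mu> K"
    using emeasure_compl_spt[OF \<mu>(2)] by simp
  have le: "emeasure \<mu> V \<le> ennreal (r (\<phi> i) powr (s - t))" for i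
  proof -
    note VK
    also have "emeasure \<mu> K \<le> ennreal (covering_number (r (\<phi> i)) K * r (\<phi> i) powr s)"
      using r' by (intro measure_le_covering_number[OF \<mu>(2) assms(1)] \<mu>(4)) auto
    also have "\<dots> \<le> ennreal (r (\<phi> i) powr (- t) * r (\<phi> i) powr s)"
      using r' by (intro ennreal_leI mult_right_mono) auto
    also have "\<dots> = ennreal (r (\<phi> i) powr (s - t))"
      by (simp add: powr_add[symmetric])
    finally show ?thesis .
  qed
  have "(\<lambda>i. r (\<phi> i)) \<longlonglongrightarrow> 0"
    using LIMSEQ_subseq_LIMSEQ[of r 0 \<phi>] r \<mu>(1) by (simp add: decreases_to_0_def o_def)
  then have "(\<lambda>i. r (\<phi> i) powr (s - t)) \<longlonglongrightarrow> 0 powr (s - t)"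
    by (rule tendsto_powr') (use t r' in \<open>auto simp: less_imp_le intro!: tendsto_intros\<close>)
  then have "(\<lambda>i. ennreal (r (\<phi> i) powr (s - t))) \<longlonglongrightarrow> 0"
    using tendsto_ennrealI by fastforce
  then have "emeasure \<mu> V \<le> 0"
    by (rule LIMSEQ_le_const) (use le in auto)
  moreover have "emeasure \<mu> V > 0"
    using emeasure_pos_if_meets_spt[OF assms(3)] assms(4) \<mu>(3) by auto
  ultimately show False by simp
qed

text \<open>Baire's theorem passes from an arbitrary countable cover to a single member that contains an
  open piece of \<open>F\<close>; only open pieces are certain to carry mass of a measure with support \<open>F\<close>.\<close>
lemma countable_closed_cover_contains_relatively_open:
  fixes F :: "'a::{real_normed_vector,heine_borel} set" and K :: "nat \<Rightarrow> 'a set"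
  assumes "closed F" "F \<noteq> {}" "\<And>i. closed (K i)" "F \<subseteq> (\<Union>i. K i)"
  obtains i V where "open V" "V \<inter> F \<noteq> {}" "V \<inter> F \<subseteq> K i"
proof -
  have "\<exists>i. \<not> F \<subseteq> closure (F - K i)"
  proof (rule ccontr)
    assume "\<not> ?thesis"
    then have dense: "\<And>i. F \<subseteq> closure (F - K i)" by blast
    have "openin (top_of_set F) (F - K i)" for i
      using assms(3) by (metis Diff_eq open_Compl openin_open_Int)
    then have "F \<subseteq> closure (\<Inter>(range (\<lambda>i. F - K i)))"
      using dense by (intro Baire[OF assms(1)]) auto
    moreover have "\<Inter>(range (\<lambda>i. F - K i)) = {}" using assms(4) by auto
    ultimately show False using assms(2) by (metis closure_empty subset_empty)
  qed
  then obtain i x where "x \<in> F" "x \<notin> closure (F - K i)" by auto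
  then show thesis
    by (intro that[of "- closure (F - K i)" i]) (use closure_subset[of "F - K i"] in auto)
qed

lemma frostman_exponent_le_modified_lower_box_dim:
  fixes E :: "'a::euclidean_space set"
  assumes "s \<in> frostman_exponents E"
  shows "ereal s \<le> modified_lower_box_dim E"
  unfolding modified_lower_box_dim_def
proof (rule Inf_greatest, clarsimp)
  obtain F where F: "F \<noteq> {}" "compact F" "F \<subseteq> E"
    and frostman: "\<And>r. decreases_to_0 r \<Longrightarrow> \<exists>\<phi> :: nat \<Rightarrow> nat. \<exists>\<mu>. strict_mono \<phi> \<and> borel_measure \<mu> \<and>
          spt \<mu> = F \<and> (\<forall>x i. emeasure \<mu> (cball x (r (\<phi> i))) \<le> ennreal (r (\<phi> i) powr s))"
    using assms by (auto simp: frostman_exponents_def)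
  fix K :: "nat \<Rightarrow> 'a set"
  assume K: "E \<subseteq> (\<Union>i. K i)" "\<forall>i. compact (K i) \<and> K i \<noteq> {}"
  obtain i V where iV: "open V" "V \<inter> F \<noteq> {}" "V \<inter> F \<subseteq> K i"
    using countable_closed_cover_contains_relatively_open[of F K] K F
    by (metis compact_imp_closed order_trans)
  have "ereal s \<le> lower_box_dim (K i)"
    by (rule frostman_exponent_le_lower_box_dim[OF _ _ iV frostman]) (use K(2) in auto)
  also have "\<dots> \<le> (SUP i. lower_box_dim (K i))" by (rule SUP_upper) simp
  finally show "ereal s \<le> (SUP i. lower_box_dim (K i))" .
qed

section \<open>A subset of large dimension at every point\<close>

text \<open>Call a set small if countably many compact sets of dimension at most \<open>s\<close> cover it. \<open>F\<close> is what
  remains of \<open>E\<close> after removing all open sets with small trace on \<open>E\<close>. By Lindelof's property the removed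
  part is small, so \<open>F\<close> is nonempty; and if \<open>F\<close> had dimension at most \<open>s\<close> in a ball around one of its
  points, then \<open>E\<close> would be small in that ball and the point would have been removed.\<close>
lemma exists_uniformly_large_subset:
  fixes E :: "'a::euclidean_space set"
  assumes "compact E" "E \<noteq> {}" "s < modified_lower_box_dim E"
  obtains F where "compact F" "F \<noteq> {}" "F \<subseteq> E"
    "\<And>x e. x \<in> F \<Longrightarrow> e > 0 \<Longrightarrow> s < lower_box_dim (F \<inter> cball x e)"
proof -
  define small where "small A \<longleftrightarrow> (\<exists>\<K>. countable \<K> \<and> A \<subseteq> \<Union>\<K> \<and>
      (\<forall>K\<in>\<K>. compact K \<and> K \<noteq> {} \<and> lower_box_dim K \<le> s))" for A :: "'a set"
  have small_Union: "small (\<Union>\<A>)" if count: "countable \<A>" and each: "\<And>A. A \<in> \<A> \<Longrightarrow> small A" for \<A>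
  proof -
    define good where "good A \<K> \<longleftrightarrow> countable \<K> \<and> A \<subseteq> \<Union>\<K> \<and>
        (\<forall>K\<in>\<K>. compact K \<and> K \<noteq> {} \<and> lower_box_dim K \<le> s)" for A :: "'a set" and \<K>
    have "\<forall>A\<in>\<A>. \<exists>\<K>. good A \<K>"
      using each unfolding small_def good_def by simp
    from bchoice[OF this] obtain c where "\<forall>A\<in>\<A>. good A (c A)" ..
    then have c: "countable (c A)" "A \<subseteq> \<Union>(c A)"
        "\<And>K. K \<in> c A \<Longrightarrow> compact K \<and> K \<noteq> {} \<and> lower_box_dim K \<le> s" if "A \<in> \<A>" for A
      using that by (auto simp: good_def)
    have "countable (\<Union>(c ` \<A>))" using c(1) count by (intro countable_UN) auto
    moreover have "\<Union>\<A> \<subseteq> \<Union>(\<Union>(c ` \<A>))"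
    proof
      fix x assume "x \<in> \<Union>\<A>"
      then obtain A where A: "A \<in> \<A>" "x \<in> A" by auto
      then have "x \<in> \<Union>(c A)" using c(2)[OF A(1)] by (rule_tac subsetD)
      then show "x \<in> \<Union>(\<Union>(c ` \<A>))" using A(1) by auto
    qed
    moreover have "\<forall>K\<in>\<Union>(c ` \<A>). compact K \<and> K \<noteq> {} \<and> lower_box_dim K \<le> s"
      using c(3) by auto
    ultimately show ?thesis unfolding small_def by blast
  qed
  have small_mono: "small A" if "small B" "A \<subseteq> B" for A B
    using that unfolding small_def by (meson order_trans)
  have not_small: "\<not> small E"
  proof
    assume "small E"
    then obtain \<K> where \<K>: "countable \<K>" "E \<subseteq> \<Union>\<K>"
        "\<forall>K\<in>\<K>. compact K \<and> K \<noteq> {} \<and> lower_box_dim K \<le> s"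
      unfolding small_def by blast
    have ne: "\<K> \<noteq> {}" using \<K>(2) assms(2) by auto
    let ?K = "from_nat_into \<K>"
    have K: "range ?K = \<K>" using ne \<K>(1) by simp
    have "E \<subseteq> (\<Union>i. ?K i)" using K \<K>(2) by simp
    moreover have "\<forall>i. compact (?K i) \<and> ?K i \<noteq> {}"
      using from_nat_into[OF ne] \<K>(3) by simp
    ultimately have "modified_lower_box_dim E \<le> (SUP i. lower_box_dim (?K i))"
      unfolding modified_lower_box_dim_def
      by (intro Inf_lower CollectI exI[of _ ?K] conjI refl)
    also have "\<dots> \<le> s" by (rule SUP_least) (use from_nat_into[OF ne] \<K>(3) in auto)
    finally show False using assms(3) by simp
  qed
  define \<V> where "\<V> = {V. open V \<and> small (E \<inter> V)}"
  obtain \<V>' where \<V>': "\<V>' \<subseteq> \<V>" "countable \<V>'" "\<Union>\<V>' = \<Union>\<V>"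
    using Lindelof[of \<V>] by (auto simp: \<V>_def)
  have small_G: "small (E \<inter> \<Union>\<V>)"
  proof -
    have "small (\<Union>((\<inter>) E ` \<V>'))"
      by (rule small_Union) (use \<V>' in \<open>auto simp: \<V>_def\<close>)
    moreover have "\<Union>((\<inter>) E ` \<V>') = E \<inter> \<Union>\<V>" using \<V>'(3) by blast
    ultimately show ?thesis by simp
  qed
  define F where "F = E - \<Union>\<V>"
  have "open (\<Union>\<V>)" by (auto simp: \<V>_def)
  then have cF: "compact F" unfolding F_def using assms(1) by (simp add: compact_diff)
  have "F \<noteq> {}"
  proof
    assume "F = {}"
    then have "E \<inter> \<Union>\<V> = E" by (auto simp: F_def)
    then show False using small_G not_small by simp
  qed
  moreover have "s < lower_box_dim (F \<inter> cball x e)" if x: "x \<in> F" "e > 0" for x e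
  proof (rule ccontr)
    assume "\<not> ?thesis"
    then have le: "lower_box_dim (F \<inter> cball x e) \<le> s" by simp
    have "compact (F \<inter> cball x e)" "F \<inter> cball x e \<noteq> {}" using cF x by (auto simp: compact_Int)
    then have "small (F \<inter> cball x e)"
      unfolding small_def using le by (intro exI[of _ "{F \<inter> cball x e}"]) auto
    then have "small (\<Union>{F \<inter> cball x e, E \<inter> \<Union>\<V>})"
      by (intro small_Union) (use small_G in auto)
    then have "small (E \<inter> ball x e)"
      by (rule small_mono) (auto simp: F_def)
    then have "ball x e \<in> \<V>" by (simp add: \<V>_def)
    then show False using x by (auto simp: F_def)
  qed
  ultimately show thesis using that cF F_def by blast
qed

section \<open>Separated points near every point of the subset\<close>

text \<open>The number on the left is that of the children at scale \<open>r\<close> in the construction below: equal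
  shares among that many points are at most \<open>r powr t\<close>. Covering numbers at scale \<open>8r\<close> exceed
  \<open>(8r) powr (-s)\<close>, and the constant \<open>8 powr (-s)\<close> is absorbed by the gap between \<open>t\<close> and \<open>s\<close>.\<close>
lemma eventually_many_separated_points:
  fixes A :: "'a::euclidean_space set"
  assumes "compact A" "A \<noteq> {}" "0 \<le> t" "t < s" "ereal s < lower_box_dim A"
  shows "\<forall>\<^sub>F r in at_right 0. nat \<lceil>r powr (- t)\<rceil> \<le> covering_number (8 * r) A"
proof -
  have "\<forall>\<^sub>F r in at_right 0. ereal s < ereal (ln (covering_number r A) / (- ln r))"
    using assms(5) unfolding lower_box_dim_def by (rule less_LiminfD)
  then obtain b where b: "b > 0"
      "\<And>r. 0 < r \<Longrightarrow> r < b \<Longrightarrow> s < ln (covering_number r A) / (- ln r)"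
    by (auto simp: eventually_at_right_field)
  have "((\<lambda>r::real. r powr (s - t)) \<longlongrightarrow> 0 powr (s - t)) (at_right 0)"
    by (rule tendsto_powr') (use assms(4) in \<open>auto simp: eventually_at_right_field intro!: exI[of _ 1] tendsto_eq_intros\<close>)
  then have "\<forall>\<^sub>F r in at_right (0::real). r powr (s - t) < 8 powr (- s)"
    by (rule order_tendstoD) simp
  moreover have "\<forall>\<^sub>F r in at_right (0::real). 0 < r \<and> r < min (b / 8) (1 / 8)"
    using b(1) by (auto simp: eventually_at_right_field intro!: exI[of _ "min (b/8) (1/8)"])
  ultimately show ?thesis
  proof eventually_elim
    case (elim r)
    have r: "0 < r" "8 * r < b" "8 * r < 1" using elim by auto
    have "s < ln (covering_number (8*r) A) / (- ln (8*r))" using b(2) r by simp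
    moreover have "- ln (8*r) > 0" using r by simp
    ultimately have "s * (- ln (8*r)) < ln (covering_number (8*r) A)"
      by (simp only: pos_less_divide_eq)
    then have "exp (- s * ln (8*r)) < exp (ln (covering_number (8*r) A))" by simp
    then have *: "(8*r) powr (- s) < covering_number (8*r) A"
      using covering_number_pos[OF assms(1,2), of "8*r"] r by (simp add: powr_def)
    have "r powr (- t) = r powr (s - t) * r powr (- s)" by (simp add: powr_add[symmetric])
    also have "\<dots> \<le> 8 powr (- s) * r powr (- s)"
      using elim by (intro mult_right_mono) auto
    also have "\<dots> = (8*r) powr (- s)" using r by (simp add: powr_mult)
    also note *
    finally have "\<lceil>r powr (- t)\<rceil> \<le> int (covering_number (8*r) A)"
      by (simp add: ceiling_le_iff)
    then show ?case by linarith
  qed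
qed

text \<open>The threshold for \<open>r\<close> is uniform in \<open>q\<close>: finitely many balls of radius \<open>\<delta>/2\<close> cover \<open>F\<close>, and
  the ball of radius \<open>\<delta>\<close> around \<open>q\<close> contains the one in which \<open>q\<close> lies. Uniformity makes it
  possible to fix all scales before any point is chosen.\<close>
lemma eventually_separated_points_everywhere:
  fixes F :: "'a::euclidean_space set"
  assumes "compact F" "0 \<le> t" "t < s" "\<delta> > 0"
    and large: "\<And>x e. x \<in> F \<Longrightarrow> e > 0 \<Longrightarrow> ereal s < lower_box_dim (F \<inter> cball x e)"
  shows "\<forall>\<^sub>F r in at_right 0. \<forall>q\<in>F. \<exists>S::nat \<Rightarrow> 'a.
           (\<forall>m < nat \<lceil>r powr (- t)\<rceil>. S m \<in> F \<inter> cball q \<delta>) \<and>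
           (\<forall>m < nat \<lceil>r powr (- t)\<rceil>. \<forall>m' < nat \<lceil>r powr (- t)\<rceil>. m \<noteq> m' \<longrightarrow> dist (S m) (S m') > 4 * r)"
proof -
  have "F \<subseteq> (\<Union>a\<in>F. ball a (\<delta>/2))" using assms(4) by auto
  then obtain D where D: "D \<subseteq> F" "finite D" "F \<subseteq> (\<Union>a\<in>D. ball a (\<delta>/2))"
    using compactE_image[OF assms(1), of F "\<lambda>a. ball a (\<delta>/2)"] by auto
  have "\<forall>\<^sub>F r in at_right 0. nat \<lceil>r powr (- t)\<rceil> \<le> covering_number (8 * r) (F \<inter> cball a (\<delta>/2))"
    if "a \<in> D" for a
  proof (rule eventually_many_separated_points[OF _ _ assms(2,3)])
    show "compact (F \<inter> cball a (\<delta>/2))" using assms(1) by (simp add: compact_Int)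
    show "F \<inter> cball a (\<delta>/2) \<noteq> {}" using that D(1) assms(4) by auto
    show "ereal s < lower_box_dim (F \<inter> cball a (\<delta>/2))" using that D(1) assms(4) by (intro large) auto
  qed
  then have "\<forall>\<^sub>F r in at_right 0. \<forall>a\<in>D. nat \<lceil>r powr (- t)\<rceil> \<le> covering_number (8 * r) (F \<inter> cball a (\<delta>/2))"
    by (intro eventually_ball_finite D(2)) auto
  moreover have "\<forall>\<^sub>F r in at_right (0::real). 0 < r" by (simp add: eventually_at_right_less)
  ultimately show ?thesis
  proof eventually_elim
    case (elim r)
    define N where "N = nat \<lceil>r powr (- t)\<rceil>"
    show ?case unfolding N_def[symmetric]
    proof
      fix q assume "q \<in> F"
      then obtain a where a: "a \<in> D" "dist a q < \<delta>/2" using D(3) by auto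
      have "N \<le> covering_number (8 * r) (F \<inter> cball a (\<delta>/2))" using elim(1) a(1) by (simp add: N_def)
      from exists_separated_set[OF elim(2) this] obtain T where T: "finite T" "card T = N"
        "T \<subseteq> F \<inter> cball a (\<delta>/2)" "\<And>x y. x \<in> T \<Longrightarrow> y \<in> T \<Longrightarrow> x \<noteq> y \<Longrightarrow> dist x y > 4 * r"
        by blast
      obtain S where S: "bij_betw S {0..<N} T"
        using ex_bij_betw_nat_finite[OF T(1)] T(2) by blast
      have mem: "S m \<in> T" if "m < N" for m using that S by (auto simp: bij_betw_def)
      have inj: "S m \<noteq> S m'" if "m < N" "m' < N" "m \<noteq> m'" for m m'
        using that S by (auto simp: bij_betw_def inj_on_def)
      have "F \<inter> cball a (\<delta>/2) \<subseteq> F \<inter> cball q \<delta>"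
      proof
        fix y assume y: "y \<in> F \<inter> cball a (\<delta>/2)"
        then have "dist q y \<le> \<delta>" using a(2) dist_triangle2[of q y a] dist_commute[of y a] dist_commute[of q a]
          by simp
        then show "y \<in> F \<inter> cball q \<delta>" using y by simp
      qed
      then show "\<exists>S. (\<forall>m<N. S m \<in> F \<inter> cball q \<delta>) \<and>
          (\<forall>m<N. \<forall>m'<N. m \<noteq> m' \<longrightarrow> dist (S m) (S m') > 4 * r)"
        using mem inj T(3,4) by (intro exI[of _ S]) blast
    qed
  qed
qed

section \<open>Cantor measures and weighted sums\<close>

text \<open>The measure is the image of Lebesgue measure on \<open>[0,1)\<close> under a limit of step functions. Stage \<open>i\<close>
  divides \<open>[0,1)\<close> into \<open>Q i = M 0 * \<dots> * M (i - 1)\<close> intervals of equal length and maps the \<open>j\<close>-th one to the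
  point \<open>a i j\<close>; the next stage divides each interval into \<open>M i\<close> parts and sends them to the separated
  points near \<open>a i j\<close>. The steps \<open>r i - r (Suc i)\<close> telescope, so the limit stays within \<open>r i\<close>
  of stage \<open>i\<close>. Hence a ball of radius \<open>r (Suc i)\<close> for the limit becomes a ball of twice the radius
  for stage \<open>Suc i\<close>. As its diameter is \<open>4 * r (Suc i)\<close>, it contains at most one child of each of the
  \<open>Q i\<close> parents, and each child has mass \<open>1 / (Q i * M i)\<close>.\<close>
lemma exists_cantor_measure:
  fixes F :: "'a::euclidean_space set" and r :: "nat \<Rightarrow> real" and M :: "nat \<Rightarrow> nat"
  assumes "closed F" "p \<in> F" and r: "\<And>i. 0 < r i" "r \<longlonglongrightarrow> 0" and M: "\<And>i. 0 < M i"
    and split: "\<And>i q. q \<in> F \<Longrightarrow> \<exists>S::nat \<Rightarrow> 'a. (\<forall>m < M i. S m \<in> F \<inter> cball q (r i - r (Suc i))) \<and>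
        (\<forall>m < M i. \<forall>m' < M i. m \<noteq> m' \<longrightarrow> dist (S m) (S m') > 4 * r (Suc i))"
  obtains \<nu> :: "'a measure" where "sets \<nu> = sets borel" "emeasure \<nu> UNIV = 1"
    "emeasure \<nu> (- (F \<inter> cball p (r 0))) = 0"
    "\<And>i x. emeasure \<nu> (cball x (r (Suc i))) \<le> ennreal (1 / M i)"
proof -
  have "\<exists>S :: nat \<Rightarrow> 'a \<Rightarrow> nat \<Rightarrow> 'a. \<forall>i. \<forall>q\<in>F. (\<forall>m < M i. S i q m \<in> F \<inter> cball q (r i - r (Suc i))) \<and>
      (\<forall>m < M i. \<forall>m' < M i. m \<noteq> m' \<longrightarrow> dist (S i q m) (S i q m') > 4 * r (Suc i))"
    by (intro choice allI bchoice ballI split)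
  then obtain S :: "nat \<Rightarrow> 'a \<Rightarrow> nat \<Rightarrow> 'a"
    where S_mem: "\<And>i q m. q \<in> F \<Longrightarrow> m < M i \<Longrightarrow> S i q m \<in> F \<and> dist q (S i q m) \<le> r i - r (Suc i)"
      and S_sep: "\<And>i q m m'. q \<in> F \<Longrightarrow> m < M i \<Longrightarrow> m' < M i \<Longrightarrow> m \<noteq> m' \<Longrightarrow>
        dist (S i q m) (S i q m') > 4 * r (Suc i)"
    by (simp add: Ball_def) metis
  define a where "a = rec_nat (\<lambda>j. p) (\<lambda>i f j. S i (f (j div M i)) (j mod M i))"
  have a0: "a 0 j = p" and aSuc: "a (Suc i) j = S i (a i (j div M i)) (j mod M i)" for i j
    by (simp_all add: a_def)
  have a_mem: "a i j \<in> F" for i j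
    by (induction i arbitrary: j) (use assms(2) S_mem M in \<open>auto simp: a0 aSuc\<close>)
  \<comment> \<open>\<open>J i w\<close> is the index of the stage-\<open>i\<close> interval containing \<open>w\<close>, and \<open>J_div\<close> says that the parent of an
    interval contains it.\<close>
  define Q where "Q i = (\<Prod>k<i. M k)" for i
  have QSuc: "Q (Suc i) = Q i * M i" and Qpos: "Q i > 0" for i
    using M by (auto simp: Q_def intro!: prod_pos)
  define J where "J i w = nat \<lfloor>w * real (Q i)\<rfloor>" for i and w :: real
  have J_div: "J (Suc i) w div M i = J i w" for i w
  proof -
    have "\<lfloor>w * real (Q i)\<rfloor> = \<lfloor>w * real (Q (Suc i)) / real_of_int (int (M i))\<rfloor>"
      using M[of i] by (simp add: QSuc)
    also have "\<dots> = \<lfloor>w * real (Q (Suc i))\<rfloor> div int (M i)"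
      by (rule floor_divide_real_eq_div) simp
    finally show ?thesis by (simp add: J_def nat_div_distrib')
  qed
  define f where "f i w = a i (J i w)" for i w
  have f_mem: "f i w \<in> F" for i w by (simp add: f_def a_mem)
  have f_step: "dist (f i w) (f (Suc i) w) \<le> r i - r (Suc i)" for i w
    using S_mem[OF a_mem, of "J (Suc i) w mod M i" i i "J i w"] M[of i]
    by (simp add: f_def aSuc J_div)
  have f_dist: "dist (f i w) (f (i + k) w) \<le> r i - r (i + k)" for i k w
  proof (induction k)
    case (Suc k)
    then show ?case
      using f_step[of "i+k" w] dist_triangle[of "f i w" "f (i + Suc k) w" "f (i+k) w"] by simp
  qed simp
  have f_dist': "dist (f i w) (f j w) \<le> r i" if "i \<le> j" for i j w
    using f_dist[of i w "j - i"] that r(1)[of j] by simp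
  have "Cauchy (\<lambda>i. f i w)" for w
  proof (rule metric_CauchyI)
    fix e :: real assume "e > 0"
    then obtain N where N: "r N < e / 2"
      using order_tendstoD(2)[OF r(2), of "e/2"] by (auto simp: eventually_sequentially)
    show "\<exists>N. \<forall>m\<ge>N. \<forall>n\<ge>N. dist (f m w) (f n w) < e"
    proof (intro exI allI impI)
      fix m n assume "N \<le> m" "N \<le> n"
      then show "dist (f m w) (f n w) < e"
        using f_dist'[of N m w] f_dist'[of N n w] N dist_triangle3[of "f m w" "f n w" "f N w"] by simp
    qed
  qed
  then have "\<And>w. convergent (\<lambda>i. f i w)" by (simp add: Cauchy_convergent_iff)
  then obtain g where g: "\<And>w. (\<lambda>i. f i w) \<longlonglongrightarrow> g w"
    unfolding convergent_def by metis
  have g_mem: "g w \<in> F" for w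
    using closed_sequentially[OF assms(1) _ g] f_mem by blast
  have g_dist: "dist (f i w) (g w) \<le> r i" for i w
    by (rule LIMSEQ_le_const2[OF tendsto_dist[OF tendsto_const g]]) (use f_dist' in blast)
  have [measurable]: "J i \<in> borel \<rightarrow>\<^sub>M count_space UNIV" for i
    unfolding J_def by measurable
  have f_meas: "f i \<in> borel_measurable borel" for i
  proof -
    have "(\<lambda>w. a i (J i w)) \<in> borel_measurable borel"
      by (rule measurable_compose[of "J i" borel "count_space UNIV" "a i"]) simp_all
    then show ?thesis by (simp add: f_def[abs_def])
  qed
  have g_meas[measurable]: "g \<in> borel_measurable borel"
    by (rule borel_measurable_LIMSEQ_metric[OF f_meas g])
  define \<Omega> where "\<Omega> = restrict_space lborel {0..<1::real}"
  define \<nu> where "\<nu> = distr \<Omega> borel g"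
  have g_meas': "g \<in> borel_measurable \<Omega>"
    unfolding \<Omega>_def by (rule measurable_restrict_space1) simp
  have \<nu>: "emeasure \<nu> A = emeasure lborel {w \<in> {0..<1}. g w \<in> A}" if "A \<in> sets borel" for A
  proof -
    have "emeasure \<nu> A = emeasure \<Omega> (g -` A \<inter> space \<Omega>)"
      unfolding \<nu>_def by (rule emeasure_distr[OF g_meas' that])
    also have "\<dots> = emeasure lborel (g -` A \<inter> space \<Omega>)"
      unfolding \<Omega>_def by (rule emeasure_restrict_space) auto
    also have "g -` A \<inter> space \<Omega> = {w \<in> {0..<1}. g w \<in> A}" by (auto simp: \<Omega>_def)
    finally show ?thesis .
  qed
  show thesis
  proof (rule that[of \<nu>])
    show "sets \<nu> = sets borel" by (simp add: \<nu>_def)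
    have "emeasure lborel {w. 0 \<le> w \<and> w < (1::real)} = 1"
      using emeasure_lborel_Ico[of 0 1] by (simp add: atLeastLessThan_def atLeast_def lessThan_def Int_def)
    then show "emeasure \<nu> UNIV = 1" by (simp add: \<nu>)
    have "dist p (g w) \<le> r 0" for w using g_dist[of 0 w] by (simp add: f_def a0)
    then have "{w \<in> {0..<1}. g w \<in> - (F \<inter> cball p (r 0))} = {}" using g_mem by auto
    moreover have "- (F \<inter> cball p (r 0)) \<in> sets borel"
      using assms(1) by (auto intro!: borel_open simp: open_Compl closed_Int)
    ultimately show "emeasure \<nu> (- (F \<inter> cball p (r 0))) = 0"
      by (simp only: \<nu> emeasure_empty)
  next
    fix i x
    define B where "B = {j \<in> {..<Q (Suc i)}. a (Suc i) j \<in> cball x (2 * r (Suc i))}"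
    define I where "I j = {real j / Q (Suc i) ..< real (Suc j) / Q (Suc i)}" for j
    \<comment> \<open>\<open>B\<close> collects the intervals that can reach the ball, with its radius doubled to account for the
      distance between stage \<open>Suc i\<close> and the limit.\<close>
    have sub: "{w \<in> {0..<1}. g w \<in> cball x (r (Suc i))} \<subseteq> (\<Union>j\<in>B. I j)"
    proof
      fix w assume w: "w \<in> {w \<in> {0..<1}. g w \<in> cball x (r (Suc i))}"
      let ?j = "J (Suc i) w"
      have nonneg: "0 \<le> w * Q (Suc i)" using w by simp
      have fl: "real ?j = of_int \<lfloor>w * Q (Suc i)\<rfloor>" using nonneg by (simp add: J_def)
      have "real ?j \<le> w * Q (Suc i)" "w * Q (Suc i) < real ?j + 1" unfolding fl by linarith+
      then have "w \<in> I ?j" using Qpos[of "Suc i"] by (simp add: I_def field_simps)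
      moreover have "?j < Q (Suc i)"
      proof -
        have "w * Q (Suc i) < 1 * real (Q (Suc i))" using w Qpos[of "Suc i"] by (intro mult_strict_right_mono) auto
        then have "real ?j < Q (Suc i)" using \<open>real ?j \<le> w * Q (Suc i)\<close> by simp
        then show ?thesis by simp
      qed
      moreover have "dist x (f (Suc i) w) \<le> 2 * r (Suc i)"
        using g_dist[of "Suc i" w] w dist_triangle2[of x "f (Suc i) w" "g w"] by simp
      ultimately show "w \<in> (\<Union>j\<in>B. I j)" by (auto simp: B_def f_def)
    qed
    have card: "card B \<le> Q i"
    proof -
      have "inj_on (\<lambda>j. j div M i) B"
      proof (rule inj_onI)
        fix j j' assume j: "j \<in> B" "j' \<in> B" and eq: "j div M i = j' div M i"
        have "dist (a (Suc i) j) (a (Suc i) j') \<le> 4 * r (Suc i)"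
          using j dist_triangle3[of "a (Suc i) j" "a (Suc i) j'" x] by (simp add: B_def)
        then have "j mod M i = j' mod M i"
          using S_sep[OF a_mem, of "j mod M i" i "j' mod M i" i "j' div M i"] M[of i] eq
          by (fastforce simp: aSuc)
        then show "j = j'" using eq by (metis div_mult_mod_eq)
      qed
      moreover have "(\<lambda>j. j div M i) ` B \<subseteq> {..<Q i}"
        by (auto simp: B_def QSuc less_mult_imp_div_less)
      ultimately show ?thesis using card_inj_on_le[of _ B "{..<Q i}"] by simp
    qed
    have "emeasure \<nu> (cball x (r (Suc i))) \<le> emeasure lborel (\<Union>j\<in>B. I j)"
    proof (subst \<nu>)
      show "emeasure lborel {w \<in> {0..<1}. g w \<in> cball x (r (Suc i))} \<le> emeasure lborel (\<Union>j\<in>B. I j)"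
        by (rule emeasure_mono[OF sub]) (auto simp: B_def I_def)
    qed simp
    also have "\<dots> \<le> (\<Sum>j\<in>B. emeasure lborel (I j))"
      by (rule emeasure_subadditive_finite) (auto simp: B_def I_def)
    also have "\<dots> = (\<Sum>j\<in>B. ennreal (1 / Q (Suc i)))"
      by (intro sum.cong refl) (simp add: I_def divide_right_mono flip: diff_divide_distrib)
    also have "\<dots> = ennreal (card B / Q (Suc i))"
      by (simp add: ennreal_of_nat_eq_real_of_nat flip: ennreal_mult)
    also have "\<dots> \<le> ennreal (Q i / Q (Suc i))"
      using card by (intro ennreal_leI divide_right_mono) auto
    also have "Q i / Q (Suc i) = 1 / M i" using Qpos[of i] by (simp add: QSuc)
    finally show "emeasure \<nu> (cball x (r (Suc i))) \<le> ennreal (1 / M i)" .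
  qed
qed

text \<open>Countable additivity is an interchange of two sums of nonnegative terms, obtained here from
  monotone convergence for the counting measure.\<close>
lemma exists_weighted_sum_measure:
  fixes \<nu> :: "nat \<Rightarrow> 'a::topological_space measure" and c :: "nat \<Rightarrow> ennreal"
  assumes sets: "\<And>n. sets (\<nu> n) = sets borel"
  obtains \<mu> :: "'a measure" where "sets \<mu> = sets borel"
    "\<And>A. A \<in> sets borel \<Longrightarrow> emeasure \<mu> A = (\<Sum>n. c n * emeasure (\<nu> n) A)"
proof -
  define m where "m A = (\<Sum>n. c n * emeasure (\<nu> n) A)" for A
  define \<mu> where "\<mu> = measure_of UNIV (sets (borel :: 'a measure)) m"
  have "emeasure \<mu> A = m A" if A: "A \<in> sets borel" for A
    unfolding \<mu>_def
  proof (rule emeasure_measure_of_sigma[OF _ _ _ A])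
    show "sigma_algebra UNIV (sets (borel :: 'a measure))"
      using sets.sigma_algebra_axioms[of "borel :: 'a measure"] by simp
    show "positive (sets borel) m" by (simp add: positive_def m_def)
    show "countably_additive (sets borel) m"
    proof (rule countably_additiveI)
      fix B :: "nat \<Rightarrow> 'a set"
      assume B: "range B \<subseteq> sets borel" "disjoint_family B"
      have "(\<Sum>i. m (B i)) = (\<Sum>i. \<integral>\<^sup>+n. c n * emeasure (\<nu> n) (B i) \<partial>count_space UNIV)"
        by (simp add: m_def nn_integral_count_space_nat)
      also have "\<dots> = (\<integral>\<^sup>+n. (\<Sum>i. c n * emeasure (\<nu> n) (B i)) \<partial>count_space UNIV)"
        by (rule nn_integral_suminf[symmetric]) simp
      also have "\<dots> = (\<Sum>n. c n * (\<Sum>i. emeasure (\<nu> n) (B i)))"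
        by (simp add: nn_integral_count_space_nat)
      also have "\<dots> = m (\<Union>i. B i)"
        unfolding m_def using B sets by (intro suminf_cong arg_cong[where f="(*) _"] suminf_emeasure) auto
      finally show "(\<Sum>i. m (B i)) = m (\<Union>i. B i)" .
    qed
  qed
  moreover have "sets \<mu> = sets borel"
    unfolding \<mu>_def by (metis sets.sigma_sets_eq sets_measure_of space_borel sets.space_closed)
  ultimately show thesis using that by (simp add: m_def)
qed

section \<open>A measure with full support and prescribed decay\<close>

text \<open>The subsequence is chosen such that each scale allows the branching required by
  \<open>exists_cantor_measure\<close> relative to the preceding scale, whichever point is split. One subsequence
  therefore serves Cantor measures started at any stage and at any point of \<open>F\<close>. The \<open>n\<close>-th one
  starts at stage \<open>n\<close>: the Cantor bound holds at the scales \<open>\<rho> i\<close> with \<open>i > n\<close>, and at the others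
  its weight is at most \<open>\<rho> n powr t \<le> \<rho> i powr t\<close>.\<close>
lemma exists_frostman_measure:
  fixes F :: "'a::euclidean_space set"
  assumes F: "compact F" "F \<noteq> {}" and t: "0 \<le> t" "t < s"
    and large: "\<And>x e. x \<in> F \<Longrightarrow> e > 0 \<Longrightarrow> ereal s < lower_box_dim (F \<inter> cball x e)"
    and r: "decreases_to_0 r"
  shows "\<exists>\<phi> :: nat \<Rightarrow> nat. \<exists>\<mu>. strict_mono \<phi> \<and> borel_measure \<mu> \<and> spt \<mu> = F \<and>
           (\<forall>x i. emeasure \<mu> (cball x (r (\<phi> i))) \<le> ennreal (r (\<phi> i) powr t))"
proof -
  have rpos: "\<And>k. 0 < r k" and rdec: "decseq r" and rlim: "r \<longlonglongrightarrow> 0"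
    using r by (auto simp: decreases_to_0_def)
  define N where "N \<rho> = nat \<lceil>\<rho> powr (- t)\<rceil>" for \<rho> :: real
  define P where "P \<delta> \<rho> \<longleftrightarrow> (\<forall>q\<in>F. \<exists>S::nat \<Rightarrow> 'a. (\<forall>m < N \<rho>. S m \<in> F \<inter> cball q \<delta>) \<and>
           (\<forall>m < N \<rho>. \<forall>m' < N \<rho>. m \<noteq> m' \<longrightarrow> dist (S m) (S m') > 4 * \<rho>))" for \<delta> \<rho> :: real
  have "\<forall>\<^sub>F k in sequentially. r k \<in> {0<..} \<and> r k \<noteq> 0"
    using rpos by (auto simp: less_imp_neq[symmetric])
  then have rright: "filterlim r (at_right 0) sequentially"
    using rlim by (simp add: filterlim_at)
  have next_scale: "\<exists>k'>k. r k' \<le> r k / 2 \<and> P (r k / 2) (r k')" for k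
  proof -
    have "\<forall>\<^sub>F \<rho> in at_right 0. P (r k / 2) \<rho>"
      unfolding P_def N_def
      by (rule eventually_separated_points_everywhere[OF F(1) t]) (use rpos large in auto)
    then have "\<forall>\<^sub>F k' in sequentially. P (r k / 2) (r k')"
      using rright by (rule eventually_compose_filterlim)
    moreover have "\<forall>\<^sub>F k' in sequentially. r k' < r k / 2"
      by (rule eventually_small_radius[OF r]) (use rpos in auto)
    moreover have "\<forall>\<^sub>F k' in sequentially. k < k'" by (rule eventually_gt_at_top)
    ultimately have "\<forall>\<^sub>F k' in sequentially. k' > k \<and> r k' \<le> r k / 2 \<and> P (r k / 2) (r k')"
      by eventually_elim auto
    then show ?thesis by (auto simp: eventually_sequentially)
  qed
  have "\<exists>\<phi>. \<forall>n. True \<and> (\<phi> (Suc n) > \<phi> n \<and> r (\<phi> (Suc n)) \<le> r (\<phi> n) / 2 \<and> P (r (\<phi> n) / 2) (r (\<phi> (Suc n))))"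
    by (rule dependent_nat_choice) (use next_scale in auto)
  then obtain \<phi> where \<phi>: "\<And>n. \<phi> n < \<phi> (Suc n)" "\<And>n. r (\<phi> (Suc n)) \<le> r (\<phi> n) / 2"
      "\<And>n. P (r (\<phi> n) / 2) (r (\<phi> (Suc n)))"
    by auto
  have mono: "strict_mono \<phi>" using \<phi>(1) by (simp add: strict_mono_Suc_iff)
  define \<rho> where "\<rho> i = r (\<phi> i)" for i
  have \<rho>pos: "\<rho> i > 0" for i by (simp add: \<rho>_def rpos)
  have \<rho>lim: "\<rho> \<longlonglongrightarrow> 0"
    using LIMSEQ_subseq_LIMSEQ[OF rlim mono] by (simp add: \<rho>_def[abs_def] o_def)
  have \<rho>dec: "\<rho> j \<le> \<rho> i" if "i \<le> j" for i j
    using that mono rdec by (simp add: \<rho>_def decseqD strict_mono_less_eq)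
  have Npos: "N (\<rho> i) > 0" for i using \<rho>pos[of i] by (simp add: N_def)
  have Nbound: "1 / N (\<rho> i) \<le> \<rho> i powr t" for i
  proof -
    have "\<rho> i powr (- t) \<le> N (\<rho> i)" unfolding N_def by (rule real_nat_ceiling_ge)
    then have "1 / N (\<rho> i) \<le> 1 / \<rho> i powr (- t)"
      using \<rho>pos[of i] by (intro divide_left_mono) (auto simp: Npos)
    then show ?thesis by (simp add: powr_minus_divide)
  qed
  obtain D where D: "countable D" "D \<subseteq> F" "F \<subseteq> closure D" using separable[of F] by metis
  have "D \<noteq> {}" using D(3) F(2) by auto
  define d where "d = from_nat_into D"
  have d: "range d = D" using D(1) \<open>D \<noteq> {}\<close> by (simp add: d_def)
  \<comment> \<open>Each point of the dense sequence recurs infinitely often, hence also at stages where the Cantor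
    measure started there is concentrated in an arbitrarily small ball.\<close>
  define x where "x n = d (fst (prod_decode n))" for n
  have "x n \<in> F" for n using d D(2) by (auto simp: x_def)
  have "\<exists>\<nu> :: 'a measure. sets \<nu> = sets borel \<and> emeasure \<nu> UNIV = 1 \<and>
      emeasure \<nu> (- (F \<inter> cball (x n) (\<rho> n))) = 0 \<and>
      (\<forall>i y. emeasure \<nu> (cball y (\<rho> (n + Suc i))) \<le> ennreal (1 / N (\<rho> (n + Suc i))))" for n
  proof -
    have split: "\<exists>S::nat \<Rightarrow> 'a. (\<forall>m < N (\<rho> (n + Suc i)). S m \<in> F \<inter> cball q (\<rho> (n + i) - \<rho> (n + Suc i))) \<and>
        (\<forall>m < N (\<rho> (n + Suc i)). \<forall>m' < N (\<rho> (n + Suc i)). m \<noteq> m' \<longrightarrow> dist (S m) (S m') > 4 * \<rho> (n + Suc i))"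
      if q: "q \<in> F" for i q
    proof -
      \<comment> \<open>Scales at least halve, so the allowed step is no smaller than the radius used for \<open>P\<close>.\<close>
      have "\<rho> (n + i) / 2 \<le> \<rho> (n + i) - \<rho> (n + Suc i)"
        using \<phi>(2)[of "n+i"] by (simp add: \<rho>_def field_simps)
      then have sub: "F \<inter> cball q (\<rho> (n + i) / 2) \<subseteq> F \<inter> cball q (\<rho> (n + i) - \<rho> (n + Suc i))"
        by (intro Int_mono subset_cball) auto
      have "P (\<rho> (n + i) / 2) (\<rho> (n + Suc i))"
        using \<phi>(3)[of "n+i"] by (simp add: \<rho>_def)
      then obtain S :: "nat \<Rightarrow> 'a" where
          S: "\<forall>m < N (\<rho> (n + Suc i)). S m \<in> F \<inter> cball q (\<rho> (n + i) / 2)"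
            "\<forall>m < N (\<rho> (n + Suc i)). \<forall>m' < N (\<rho> (n + Suc i)). m \<noteq> m' \<longrightarrow>
              dist (S m) (S m') > 4 * \<rho> (n + Suc i)"
        using bspec[OF _ q] unfolding P_def by blast
      show ?thesis
        by (rule exI[of _ S], rule conjI[OF _ S(2)]) (use S(1) sub in blast)
    qed
    have lim: "(\<lambda>i. \<rho> (n + i)) \<longlonglongrightarrow> 0"
      using LIMSEQ_ignore_initial_segment[OF \<rho>lim, of n] by (simp add: add.commute)
    from exists_cantor_measure[of F "x n" "\<lambda>i. \<rho> (n + i)" "\<lambda>i. N (\<rho> (n + Suc i))",
        OF compact_imp_closed[OF F(1)] \<open>x n \<in> F\<close> \<rho>pos lim Npos split]
    obtain \<nu> :: "'a measure" where "sets \<nu> = sets borel" "emeasure \<nu> UNIV = 1"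
        "emeasure \<nu> (- (F \<inter> cball (x n) (\<rho> (n + 0)))) = 0"
        "\<And>i y. emeasure \<nu> (cball y (\<rho> (n + Suc i))) \<le> ennreal (1 / N (\<rho> (n + Suc i)))"
      by blast
    then show ?thesis by (intro exI[of _ \<nu>]) simp
  qed
  then obtain \<nu> :: "nat \<Rightarrow> 'a measure" where \<nu>sets: "\<And>n. sets (\<nu> n) = sets borel"
      and \<nu>UNIV: "\<And>n. emeasure (\<nu> n) UNIV = 1"
      and \<nu>null: "\<And>n. emeasure (\<nu> n) (- (F \<inter> cball (x n) (\<rho> n))) = 0"
      and \<nu>bound: "\<And>n i y. emeasure (\<nu> n) (cball y (\<rho> (n + Suc i))) \<le> ennreal (1 / N (\<rho> (n + Suc i)))"
    by metis
  \<comment> \<open>The minimum with \<open>1\<close> covers early scales, which may exceed \<open>1\<close>.\<close>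
  define c where "c n = min 1 (\<rho> n powr t) * (1/2) ^ Suc n" for n
  obtain \<mu> :: "'a measure" where \<mu>: "sets \<mu> = sets borel"
      "\<And>A. A \<in> sets borel \<Longrightarrow> emeasure \<mu> A = (\<Sum>n. ennreal (c n) * emeasure (\<nu> n) A)"
    using exists_weighted_sum_measure[of \<nu> "\<lambda>n. ennreal (c n)"] \<nu>sets by blast
  have "emeasure \<mu> (cball y (\<rho> i)) \<le> ennreal (\<rho> i powr t)" for y i
  proof -
    have "ennreal (c n) * emeasure (\<nu> n) (cball y (\<rho> i)) \<le> ennreal (\<rho> i powr t * (1/2) ^ Suc n)" for n
    proof (cases "n < i")
      case True
      then have i: "i = n + Suc (i - Suc n)" by simp
      have "emeasure (\<nu> n) (cball y (\<rho> i)) \<le> ennreal (1 / N (\<rho> i))"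
        using \<nu>bound[of n y "i - Suc n"] i by simp
      also have "\<dots> \<le> ennreal (\<rho> i powr t)" by (rule ennreal_leI[OF Nbound])
      finally have "ennreal (c n) * emeasure (\<nu> n) (cball y (\<rho> i)) \<le> ennreal ((1/2) ^ Suc n) * ennreal (\<rho> i powr t)"
        by (intro mult_mono ennreal_leI) (auto simp: c_def mult_left_le_one_le)
      then show ?thesis by (simp add: mult.commute flip: ennreal_mult)
    next
      case False
      have "emeasure (\<nu> n) (cball y (\<rho> i)) \<le> 1"
        using emeasure_mono[of "cball y (\<rho> i)" UNIV "\<nu> n"] \<nu>UNIV \<nu>sets by simp
      moreover have "\<rho> n powr t \<le> \<rho> i powr t"
        using False \<rho>dec[of i n] \<rho>pos[of n] t by (intro powr_mono2) auto
      then have "c n \<le> \<rho> i powr t * (1/2) ^ Suc n"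
        unfolding c_def by (intro mult_right_mono) auto
      ultimately show ?thesis using mult_mono[OF ennreal_leI, of "c n" _ _ 1] by simp
    qed
    then have "emeasure \<mu> (cball y (\<rho> i)) \<le> (\<Sum>n. ennreal (\<rho> i powr t * (1/2) ^ Suc n))"
      by (subst \<mu>(2)) (auto intro!: suminf_le)
    also have "\<dots> = ennreal (\<rho> i powr t * 1)"
      by (rule suminf_ennreal_eq[OF _ sums_mult[OF power_half_series]]) simp
    finally show ?thesis by simp
  qed
  moreover have "spt \<mu> = F"
  proof
    have "emeasure (\<nu> n) (- F) = 0" for n
    proof -
      have "emeasure (\<nu> n) (- F) \<le> emeasure (\<nu> n) (- (F \<inter> cball (x n) (\<rho> n)))"
        using F(1) \<nu>sets by (intro emeasure_mono) (auto intro!: borel_open simp: open_Compl compact_imp_closed closed_Int)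
      then show ?thesis using \<nu>null[of n] by simp
    qed
    then have "emeasure \<mu> (- F) = 0"
      using F(1) by (subst \<mu>(2)) (auto intro!: borel_open simp: open_Compl compact_imp_closed)
    moreover have "open (- F)" using F(1) by (simp add: open_Compl compact_imp_closed)
    ultimately show "spt \<mu> \<subseteq> F" unfolding spt_def by blast
  next
    show "F \<subseteq> spt \<mu>"
    proof
      fix z assume z: "z \<in> F"
      have False if U: "open U" "emeasure \<mu> U = 0" "z \<in> U" for U
      proof -
        obtain e where e: "e > 0" "ball z e \<subseteq> U" using U by (meson open_contains_ball)
        have "z \<in> closure D" "e / 2 > 0" using D(3) z e(1) by auto
        then obtain y where "y \<in> range d" "dist y z < e / 2"
          unfolding closure_approachable d by blast
        then obtain k where k: "dist (d k) z < e / 2" by blast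
        obtain m where m: "\<And>n. n \<ge> m \<Longrightarrow> \<rho> n < e / 2"
          using order_tendstoD(2)[OF \<rho>lim, of "e/2"] e(1) by (auto simp: eventually_sequentially)
        define n where "n = prod_encode (k, m)"
        have "x n = d k" by (simp add: x_def n_def)
        moreover have "\<rho> n < e / 2" by (rule m) (simp add: n_def le_prod_encode_2)
        ultimately have "cball (x n) (\<rho> n) \<subseteq> ball z e"
          using k by (intro cball_subset_ball_iff[THEN iffD2] disjI1) simp
        then have sub: "F \<inter> cball (x n) (\<rho> n) \<subseteq> U" using e(2) by blast
        have meas: "- (F \<inter> cball (x n) (\<rho> n)) \<in> sets borel" "U \<in> sets borel"
          using F(1) U(1) by (auto intro!: borel_open simp: open_Compl compact_imp_closed closed_Int)
        have "1 \<le> emeasure (\<nu> n) (U \<union> - (F \<inter> cball (x n) (\<rho> n)))"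
          using sub meas \<nu>sets[of n] by (subst \<nu>UNIV[of n, symmetric]) (intro emeasure_mono, auto)
        also have "\<dots> \<le> emeasure (\<nu> n) U + emeasure (\<nu> n) (- (F \<inter> cball (x n) (\<rho> n)))"
          by (rule emeasure_subadditive) (use meas \<nu>sets[of n] in auto)
        finally have "1 \<le> emeasure (\<nu> n) U" using \<nu>null by simp
        moreover have "c n > 0" using \<rho>pos[of n] by (simp add: c_def)
        ultimately have "0 < ennreal (c n) * emeasure (\<nu> n) U"
          by (auto simp: ennreal_zero_less_mult_iff intro: less_le_trans[OF zero_less_one])
        also have "\<dots> \<le> (\<Sum>n. ennreal (c n) * emeasure (\<nu> n) U)"
          using sum_le_suminf[OF summableI, of "{n}" "\<lambda>n. ennreal (c n) * emeasure (\<nu> n) U"] by simp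
        also have "\<dots> = emeasure \<mu> U" using \<mu>(2)[OF meas(2)] by simp
        finally show False using U(2) by simp
      qed
      then show "z \<in> spt \<mu>" by (auto simp: spt_def)
    qed
  qed
  ultimately show ?thesis
    using mono \<mu>(1) unfolding \<rho>_def borel_measure_def by blast
qed

section \<open>Realising exponents below the dimension\<close>

lemma frostman_exponents_if_less_dim:
  fixes E :: "'a::euclidean_space set"
  assumes "compact E" "E \<noteq> {}" "0 \<le> t" "t < s" "ereal s < modified_lower_box_dim E"
  shows "t \<in> frostman_exponents E"
proof -
  obtain F where F: "compact F" "F \<noteq> {}" "F \<subseteq> E"
      "\<And>x e. x \<in> F \<Longrightarrow> e > 0 \<Longrightarrow> ereal s < lower_box_dim (F \<inter> cball x e)"
    using exists_uniformly_large_subset[OF assms(1,2,5)] by metis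
  have "\<exists>\<phi> :: nat \<Rightarrow> nat. \<exists>\<mu>. strict_mono \<phi> \<and> borel_measure \<mu> \<and> spt \<mu> = F \<and>
           (\<forall>x i. emeasure \<mu> (cball x (r (\<phi> i))) \<le> ennreal (r (\<phi> i) powr t))"
    if "decreases_to_0 r" for r
    by (rule exists_frostman_measure[OF F(1,2) assms(3,4) F(4) that])
  then show ?thesis
    unfolding frostman_exponents_def using assms(3) F(1-3) by blast
qed

text \<open>A point mass witnesses the exponent \<open>0\<close>. Thus the supremum over the exponents is nonnegative,
  and every real number above it meets the sign condition on exponents.\<close>
lemma zero_mem_frostman_exponents:
  fixes E :: "'a::euclidean_space set"
  assumes "E \<noteq> {}"
  shows "0 \<in> frostman_exponents E"
proof -
  obtain a where a: "a \<in> E" using assms by auto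
  define \<delta> where "\<delta> = distr (count_space {()}) borel (\<lambda>_. a)"
  have \<delta>: "emeasure \<delta> A = indicator A a" if "A \<in> sets borel" for A
    using that by (simp add: \<delta>_def emeasure_distr vimage_def split: split_indicator)
  have "spt \<delta> = {a}"
  proof
    have "open (- {a})" "emeasure \<delta> (- {a}) = 0" by (auto simp: open_Compl \<delta>)
    then show "spt \<delta> \<subseteq> {a}" unfolding spt_def by blast
    have "a \<notin> U" if "open U" "emeasure \<delta> U = 0" for U
      using that \<delta>[of U] by (auto split: split_indicator_asm)
    then show "{a} \<subseteq> spt \<delta>" by (auto simp: spt_def)
  qed
  moreover have "emeasure \<delta> (cball x (r i)) \<le> ennreal (r i powr 0)" if "decreases_to_0 r" for x r and i :: nat
  proof -
    have "r i > 0" using that by (simp add: decreases_to_0_def)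
    then show ?thesis by (simp add: \<delta> split: split_indicator)
  qed
  moreover have "borel_measure \<delta>" by (simp add: borel_measure_def \<delta>_def)
  ultimately have "\<exists>\<phi> :: nat \<Rightarrow> nat. \<exists>\<mu>. strict_mono \<phi> \<and> borel_measure \<mu> \<and> spt \<mu> = {a} \<and>
           (\<forall>x i. emeasure \<mu> (cball x (r (\<phi> i))) \<le> ennreal (r (\<phi> i) powr 0))"
    if "decreases_to_0 r" for r
    using that strict_mono_id by blast
  then show ?thesis
    unfolding frostman_exponents_def using a
    by (intro CollectI conjI exI[of _ "{a}"]) auto
qed

section \<open>Logarithmic ratios\<close>

text \<open>The inequality turns around because \<open>ln r\<close> is negative; the conventions for mass \<open>0\<close> and \<open>\<infinity>\<close>
  are the ones that make the equivalence hold there too.\<close>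
lemma le_powr_iff_log_ratio:
  assumes "0 < r" "r < 1"
  shows "ereal s \<le> log_ratio m r \<longleftrightarrow> m \<le> ennreal (r powr s)"
proof (cases "m = 0 \<or> m = \<infinity>")
  case True
  then show ?thesis by (auto simp: log_ratio_def top_unique)
next
  case False
  then obtain y where y: "m = ennreal y" "y > 0"
    by (cases m) (auto simp: less_le)
  have "ln r < 0" using assms by simp
  have "ereal s \<le> log_ratio m r \<longleftrightarrow> s \<le> ln y / ln r"
    using y by (simp add: log_ratio_def)
  also have "\<dots> \<longleftrightarrow> ln y \<le> s * ln r"
    using \<open>ln r < 0\<close> by (simp add: neg_le_divide_eq)
  also have "\<dots> \<longleftrightarrow> y \<le> exp (s * ln r)"
    using y(2) by (metis exp_le_cancel_iff exp_ln)
  also have "\<dots> \<longleftrightarrow> m \<le> ennreal (r powr s)"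
    using y assms by (simp add: powr_def)
  finally show ?thesis .
qed

text \<open>Compactness gives a cover of the unit ball; translation and scaling carry it to any other ball, so
  the number of balls depends only on the space.\<close>
lemma cball_cover_by_half_balls:
  obtains C :: nat where "C > 0"
    "\<And>(x :: 'a::euclidean_space) r. r > 0 \<Longrightarrow> \<exists>c :: nat \<Rightarrow> 'a. cball x r \<subseteq> (\<Union>i<C. cball (c i) (r / 2))"
proof -
  have "cball (0::'a) 1 \<subseteq> (\<Union>a\<in>cball 0 1. ball a (1/2))"
  proof
    fix y :: 'a assume "y \<in> cball 0 1"
    then show "y \<in> (\<Union>a\<in>cball 0 1. ball a (1/2))" by (intro UN_I[of y]) auto
  qed
  then obtain D where D: "finite D" "cball (0::'a) 1 \<subseteq> (\<Union>a\<in>D. ball a (1/2))"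
    using compactE_image[OF compact_cball, of "cball (0::'a) 1" "\<lambda>a. ball a (1/2)" 0 1] open_ball
    by metis
  obtain h where h: "bij_betw h {0..<card D} D" using ex_bij_betw_nat_finite[OF D(1)] by blast
  have "D \<noteq> {}" using D(2) by auto
  show thesis
  proof (rule that[of "card D"])
    show "card D > 0" using D(1) \<open>D \<noteq> {}\<close> by (simp add: card_gt_0_iff)
    fix x :: 'a and r :: real assume r: "r > 0"
    have "cball x r \<subseteq> (\<Union>i<card D. cball (x + r *\<^sub>R h i) (r / 2))"
    proof
      fix y assume y: "y \<in> cball x r"
      define z where "z = (1/r) *\<^sub>R (y - x)"
      have "norm z = dist x y / r" using r by (simp add: z_def dist_norm norm_minus_commute)
      then have "z \<in> cball 0 1" using y r by simp
      then obtain a where a: "a \<in> D" "dist a z < 1/2" using D(2) by auto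
      obtain i where i: "i < card D" "h i = a" using h a(1) by (force simp: bij_betw_def)
      have "(x + r *\<^sub>R a) - y = r *\<^sub>R (a - z)" using r by (simp add: z_def algebra_simps)
      then have "dist (x + r *\<^sub>R a) y = r * dist a z" using r by (simp add: dist_norm)
      also have "\<dots> \<le> r * (1/2)" using a(2) r by (intro mult_left_mono) auto
      finally show "y \<in> (\<Union>i<card D. cball (x + r *\<^sub>R h i) (r / 2))" using i by auto
    qed
    then show "\<exists>c :: nat \<Rightarrow> 'a. cball x r \<subseteq> (\<Union>i<card D. cball (c i) (r / 2))"
      by (rule exI[of _ "\<lambda>i. x + r *\<^sub>R h i"])
  qed
qed

text \<open>A ball of radius \<open>r / 2\<close> is either null or lies in the ball of radius \<open>r\<close> around a point of the
  support. So bounds at centres in the support extend to all centres at the cost of a constant.\<close>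
lemma cball_measure_bound_from_spt:
  obtains C :: nat where "C > 0"
    "\<And>(\<mu> :: 'a::euclidean_space measure) r b x. borel_measure \<mu> \<Longrightarrow> r > 0 \<Longrightarrow>
       (\<forall>y\<in>spt \<mu>. emeasure \<mu> (cball y r) \<le> b) \<Longrightarrow> emeasure \<mu> (cball x r) \<le> of_nat C * b"
proof -
  obtain C :: nat where C: "C > 0"
      "\<And>(x :: 'a) r. r > 0 \<Longrightarrow> \<exists>c :: nat \<Rightarrow> 'a. cball x r \<subseteq> (\<Union>i<C. cball (c i) (r / 2))"
    by (rule cball_cover_by_half_balls[where ?'a = 'a]) (rule that)
  show thesis
  proof (rule that[OF C(1)])
    fix \<mu> :: "'a measure" and r b and x :: 'a
    assume \<mu>: "borel_measure \<mu>" "r > 0" "\<forall>y\<in>spt \<mu>. emeasure \<mu> (cball y r) \<le> b"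
    have sets: "sets \<mu> = sets borel" using \<mu>(1) by (simp add: borel_measure_def)
    obtain c where c: "cball x r \<subseteq> (\<Union>i<C. cball (c i) (r / 2))" using C(2)[OF \<mu>(2)] by blast
    have "open (- spt \<mu>)" by (auto simp: spt_def)
    then have null: "- spt \<mu> \<in> null_sets \<mu>"
      using emeasure_compl_spt[OF \<mu>(1)] sets by (auto simp: null_sets_def)
    have half: "emeasure \<mu> (cball a (r / 2)) \<le> b" for a
    proof (cases "cball a (r / 2) \<inter> spt \<mu> = {}")
      case True
      then have "cball a (r / 2) \<subseteq> - spt \<mu>" by auto
      then have "emeasure \<mu> (cball a (r / 2)) = 0"
        using null null_sets_subset[OF null] sets by (auto simp: null_sets_def)
      then show ?thesis by simp
    next
      case False
      then obtain y where y: "y \<in> spt \<mu>" "dist a y \<le> r / 2" by auto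
      have "cball a (r / 2) \<subseteq> cball y r"
      proof
        fix z assume "z \<in> cball a (r / 2)"
        then show "z \<in> cball y r" using y(2) dist_triangle3[of y z a] by simp
      qed
      then have "emeasure \<mu> (cball a (r / 2)) \<le> emeasure \<mu> (cball y r)"
        by (rule emeasure_mono) (simp add: sets)
      also have "\<dots> \<le> b" using \<mu>(3) y(1) by (rule bspec)
      finally show ?thesis .
    qed
    have "emeasure \<mu> (cball x r) \<le> emeasure \<mu> (\<Union>i<C. cball (c i) (r / 2))"
      by (rule emeasure_mono[OF c]) (auto simp: sets)
    also have "\<dots> \<le> (\<Sum>i<C. emeasure \<mu> (cball (c i) (r / 2)))"
      by (rule emeasure_subadditive_finite) (auto simp: sets)
    also have "\<dots> \<le> (\<Sum>i<C. b)" by (intro sum_mono half)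
    finally show "emeasure \<mu> (cball x r) \<le> of_nat C * b" by simp
  qed
qed

lemma frostman_exponent_le_log_ratio:
  fixes E :: "'a::euclidean_space set"
  assumes "s \<in> frostman_exponents E"
  shows "ereal s \<le> (SUP F\<in>{F. F \<noteq> {} \<and> compact F \<and> F \<subseteq> E}.
         INF r\<in>{r. decreases_to_0 r}.
           SUP \<mu>\<in>{\<mu> :: 'a measure. borel_measure \<mu> \<and> spt \<mu> = F}.
             limsup (\<lambda>k. INF x\<in>E. log_ratio (emeasure \<mu> (cball x (r k))) (r k)))"
proof -
  obtain F where F: "F \<noteq> {}" "compact F" "F \<subseteq> E"
    and frostman: "\<And>r. decreases_to_0 r \<Longrightarrow> \<exists>\<phi> :: nat \<Rightarrow> nat. \<exists>\<mu>. strict_mono \<phi> \<and> borel_measure \<mu> \<and>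
          spt \<mu> = F \<and> (\<forall>x i. emeasure \<mu> (cball x (r (\<phi> i))) \<le> ennreal (r (\<phi> i) powr s))"
    using assms by (auto simp: frostman_exponents_def)
  have "\<exists>\<mu>\<in>{\<mu> :: 'a measure. borel_measure \<mu> \<and> spt \<mu> = F}.
      ereal s \<le> limsup (\<lambda>k. INF x\<in>E. log_ratio (emeasure \<mu> (cball x (r k))) (r k))"
    if r: "decreases_to_0 r" for r
  proof -
    obtain \<phi> :: "nat \<Rightarrow> nat" and \<mu> :: "'a measure" where \<mu>: "strict_mono \<phi>" "borel_measure \<mu>" "spt \<mu> = F"
        "\<And>x i. emeasure \<mu> (cball x (r (\<phi> i))) \<le> ennreal (r (\<phi> i) powr s)"
      using frostman[OF r] by blast
    let ?L = "\<lambda>k. INF x\<in>E. log_ratio (emeasure \<mu> (cball x (r k))) (r k)"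
    have "\<forall>\<^sub>F i in sequentially. r (\<phi> i) < 1"
      using eventually_subseq[OF \<mu>(1) eventually_small_radius[OF r, of 1]] by simp
    then have "\<forall>\<^sub>F i in sequentially. ereal s \<le> (?L \<circ> \<phi>) i"
    proof eventually_elim
      case (elim i)
      have "0 < r (\<phi> i)" using r by (simp add: decreases_to_0_def)
      then show ?case
        using \<mu>(4) elim by (auto intro!: INF_greatest simp: le_powr_iff_log_ratio)
    qed
    then have "ereal s \<le> limsup (?L \<circ> \<phi>)" by (intro le_Limsup) auto
    also have "\<dots> \<le> limsup ?L" by (rule limsup_subseq_mono[OF \<mu>(1)])
    finally show ?thesis using \<mu>(2,3) by blast
  qed
  then have "ereal s \<le> (INF r\<in>{r. decreases_to_0 r}.
           SUP \<mu>\<in>{\<mu> :: 'a measure. borel_measure \<mu> \<and> spt \<mu> = F}.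
             limsup (\<lambda>k. INF x\<in>E. log_ratio (emeasure \<mu> (cball x (r k))) (r k)))"
    by (intro INF_greatest) (blast intro: SUP_upper2)
  then show ?thesis by (rule SUP_upper2[rotated]) (use F in simp)
qed

text \<open>The upper limit selects infinitely many radii at which the ratio exceeds \<open>s\<close> at all
  points of \<open>E\<close>, in particular on the support. The measure is divided by the constant needed to reach centres
  outside the support.\<close>
lemma frostman_exponents_if_less_log_ratio:
  fixes E :: "'a::euclidean_space set"
  assumes "0 \<le> s" and less: "ereal s < (SUP F\<in>{F. F \<noteq> {} \<and> compact F \<and> F \<subseteq> E}.
         INF r\<in>{r. decreases_to_0 r}.
           SUP \<mu>\<in>{\<mu> :: 'a measure. borel_measure \<mu> \<and> spt \<mu> = F}.
             limsup (\<lambda>k. INF x\<in>E. log_ratio (emeasure \<mu> (cball x (r k))) (r k)))"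
  shows "s \<in> frostman_exponents E"
proof -
  define L where "L \<mu> r k = (INF x\<in>E. log_ratio (emeasure \<mu> (cball x (r k))) (r k))"
    for \<mu> :: "'a measure" and r :: "nat \<Rightarrow> real" and k
  define H where "H F = (INF r\<in>{r. decreases_to_0 r}.
      SUP \<mu>\<in>{\<mu>. borel_measure \<mu> \<and> spt \<mu> = F}. limsup (L \<mu> r))" for F
  have "ereal s < (SUP F\<in>{F. F \<noteq> {} \<and> compact F \<and> F \<subseteq> E}. H F)"
    using less unfolding H_def L_def .
  then obtain F where F: "F \<noteq> {}" "compact F" "F \<subseteq> E" and INF: "ereal s < H F"
    by (auto simp: less_SUP_iff)
  obtain C :: nat where C: "C > 0"
    "\<And>(\<mu> :: 'a measure) r b x. borel_measure \<mu> \<Longrightarrow> r > 0 \<Longrightarrow>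
       (\<forall>y\<in>spt \<mu>. emeasure \<mu> (cball y r) \<le> b) \<Longrightarrow> emeasure \<mu> (cball x r) \<le> of_nat C * b"
    by (rule cball_measure_bound_from_spt[where ?'a = 'a]) (rule that)
  have "\<exists>\<phi> :: nat \<Rightarrow> nat. \<exists>\<mu>. strict_mono \<phi> \<and> borel_measure \<mu> \<and> spt \<mu> = F \<and>
           (\<forall>x i. emeasure \<mu> (cball x (r (\<phi> i))) \<le> ennreal (r (\<phi> i) powr s))"
    if r: "decreases_to_0 r" for r
  proof -
    have rpos: "\<And>k. 0 < r k" using r by (simp add: decreases_to_0_def)
    have "ereal s < (SUP \<mu>\<in>{\<mu>. borel_measure \<mu> \<and> spt \<mu> = F}. limsup (L \<mu> r))"
      by (rule less_le_trans[OF INF], unfold H_def, rule INF_lower) (use r in simp)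
    then obtain \<mu> where \<mu>: "borel_measure \<mu>" "spt \<mu> = F" and limsup: "ereal s < limsup (L \<mu> r)"
      by (auto simp: less_SUP_iff)
    have "\<exists>\<^sub>F k in sequentially. ereal s < L \<mu> r k"
    proof (rule ccontr)
      assume "\<not> ?thesis"
      then have "\<forall>\<^sub>F k in sequentially. L \<mu> r k \<le> ereal s"
        by (simp add: not_frequently not_less)
      from Limsup_bounded[OF this] limsup show False by simp
    qed
    moreover have "\<forall>\<^sub>F k in sequentially. r k < 1" by (rule eventually_small_radius[OF r]) simp
    ultimately have "\<exists>\<^sub>F k in sequentially. ereal s < L \<mu> r k \<and> r k < 1"
      by (rule frequently_eventually_frequently)
    then have "infinite {k. ereal s < L \<mu> r k \<and> r k < 1}"
      by (simp add: frequently_cofinite flip: cofinite_eq_sequentially)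
    from infinite_enumerate[OF this] obtain \<phi> :: "nat \<Rightarrow> nat" where \<phi>: "strict_mono \<phi>"
        "\<And>n. ereal s < L \<mu> r (\<phi> n)" "\<And>n. r (\<phi> n) < 1"
      by auto
    have onE: "emeasure \<mu> (cball y (r (\<phi> n))) \<le> ennreal (r (\<phi> n) powr s)" if "y \<in> E" for y n
    proof -
      have "L \<mu> r (\<phi> n) \<le> log_ratio (emeasure \<mu> (cball y (r (\<phi> n)))) (r (\<phi> n))"
        unfolding L_def by (rule INF_lower[OF that])
      with \<phi>(2)[of n] have "ereal s \<le> log_ratio (emeasure \<mu> (cball y (r (\<phi> n)))) (r (\<phi> n))"
        by (meson less_imp_le order_trans)
      then show ?thesis using le_powr_iff_log_ratio[OF rpos \<phi>(3)] by simp
    qed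
    define \<nu> where "\<nu> = scale_measure (ennreal (1 / C)) \<mu>"
    have "emeasure \<nu> (cball x (r (\<phi> n))) \<le> ennreal (r (\<phi> n) powr s)" for x n
    proof -
      have "emeasure \<mu> (cball x (r (\<phi> n))) \<le> of_nat C * ennreal (r (\<phi> n) powr s)"
        by (rule C(2)[OF \<mu>(1) rpos]) (use onE \<mu>(2) F(3) in blast)
      then have "emeasure \<nu> (cball x (r (\<phi> n))) \<le> ennreal (1 / C) * (of_nat C * ennreal (r (\<phi> n) powr s))"
        by (simp add: \<nu>_def mult_left_mono)
      also have "\<dots> = (ennreal (1 / C) * of_nat C) * ennreal (r (\<phi> n) powr s)"
        by (simp only: mult.assoc)
      also have "ennreal (1 / C) * of_nat C = 1"
        using C(1) by (simp add: ennreal_of_nat_eq_real_of_nat flip: ennreal_mult)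
      finally show ?thesis by simp
    qed
    moreover have "spt \<nu> = F"
    proof -
      have "emeasure \<nu> U = 0 \<longleftrightarrow> emeasure \<mu> U = 0" for U using C(1) by (simp add: \<nu>_def)
      then have "spt \<nu> = spt \<mu>" by (simp only: spt_def)
      with \<mu>(2) show ?thesis by simp
    qed
    moreover have "borel_measure \<nu>" using \<mu>(1) by (simp add: borel_measure_def \<nu>_def)
    ultimately show ?thesis using \<phi>(1) by blast
  qed
  then show ?thesis
    unfolding frostman_exponents_def using assms(1) F by blast
qed

section \<open>The variational formula\<close>

theorem theorem2p7:
  fixes E :: "'a::euclidean_space set"
  assumes "compact E" and "E \<noteq> {}"
  shows "modified_lower_box_dim E = (SUP s\<in>frostman_exponents E. ereal s) \<and>
    (SUP s\<in>frostman_exponents E. ereal s) =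
      (SUP F\<in>{F. F \<noteq> {} \<and> compact F \<and> F \<subseteq> E}.
         INF r\<in>{r. decreases_to_0 r}.
           SUP \<mu>\<in>{\<mu> :: 'a measure. borel_measure \<mu> \<and> spt \<mu> = F}.
             limsup (\<lambda>k. INF x\<in>E. log_ratio (emeasure \<mu> (cball x (r k))) (r k)))"
    (is "_ = ?S \<and> _ = ?R")
proof
  have S_upper: "ereal z \<le> ?S" if "z \<in> frostman_exponents E" for z
    using that by (rule SUP_upper)
  have nonneg: "0 \<le> z" if "?S < ereal z" for z
  proof -
    have "ereal 0 < ereal z"
      by (rule order.strict_trans1[OF S_upper[OF zero_mem_frostman_exponents[OF assms(2)]] that])
    then show ?thesis by simp
  qed
  show "modified_lower_box_dim E = ?S"
  proof (rule antisym)
    show "?S \<le> modified_lower_box_dim E"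
      by (rule SUP_least) (rule frostman_exponent_le_modified_lower_box_dim)
    show "modified_lower_box_dim E \<le> ?S"
    proof (rule ccontr)
      assume "\<not> ?thesis"
      then have "?S < modified_lower_box_dim E" by simp
      then obtain s where s: "?S < ereal s" "ereal s < modified_lower_box_dim E"
        using ereal_dense2 by blast
      then obtain t where t: "?S < ereal t" "t < s"
        using ereal_dense2[OF s(1)] by auto
      have "t \<in> frostman_exponents E"
        by (rule frostman_exponents_if_less_dim[OF assms nonneg[OF t(1)] t(2) s(2)])
      then have "ereal t \<le> ?S" by (rule S_upper)
      with t(1) show False by simp
    qed
  qed
  show "?S = ?R"
  proof (rule antisym)
    show "?S \<le> ?R" by (rule SUP_least) (rule frostman_exponent_le_log_ratio)
    show "?R \<le> ?S"
    proof (rule ccontr)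
      assume "\<not> ?thesis"
      then have "?S < ?R" by (simp only: not_le)
      then obtain s where s: "?S < ereal s" "ereal s < ?R"
        using ereal_dense2 by blast
      have "s \<in> frostman_exponents E"
        by (rule frostman_exponents_if_less_log_ratio[OF nonneg[OF s(1)] s(2)])
      then have "ereal s \<le> ?S" by (rule S_upper)
      with s(1) show False by simp
    qed
  qed
qed

end
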